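(* $\mathrm{Rs}(K_3)=\mathrm{Rs}(K_{1,3})=22$.
   Context: All graphs are finite and simple. A (not necessarily induced) subgraph $H$ of a host graph $F$ is singular if the degrees $d_F(v)$, $v\in V(H)$, taken in $F$, are all equal or pairwise distinct. In an edge 2-coloring of $K_m$, the host graph of a color is the spanning graph on all $m$ vertices formed by the edges of that color. The singular Ramsey number $\mathrm{Rs}(G)$ is the smallest integer $N$ such that for every $m\ge N$ and every 2-coloring of the edges of $K_m$, at least one of the two color graphs contains a singular subgraph isomorphic to $G$. *)

theory Defs
  imports Main "HOL-Library.Extended_Nat"
begin

record 'a ugraph =
  verts :: "'a set"
  edges :: "'a set set"

definition simple_graph :: "'a ugraph \<Rightarrow> bool" where
  "simple_graph G \<longleftrightarrow> finite (verts G) \<and> (\<forall>e\<in>edges G. e \<subseteq> verts G \<and> card e = 2)"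

definition subgraph :: "'a ugraph \<Rightarrow> 'a ugraph \<Rightarrow> bool" where
  "subgraph H F \<longleftrightarrow> simple_graph H \<and> simple_graph F \<and> verts H \<subseteq> verts F \<and> edges H \<subseteq> edges F"

definition isomorphic :: "'a ugraph \<Rightarrow> 'b ugraph \<Rightarrow> bool" where
  "isomorphic G H \<longleftrightarrow> (\<exists>f. bij_betw f (verts G) (verts H) \<and>
     (\<forall>u\<in>verts G. \<forall>v\<in>verts G. {u, v} \<in> edges G \<longleftrightarrow> {f u, f v} \<in> edges H))"

definition degree :: "'a ugraph \<Rightarrow> 'a \<Rightarrow> nat" where
  "degree G v = card {e \<in> edges G. v \<in> e}"

definition complete_graph :: "nat \<Rightarrow> nat ugraph" where
  "complete_graph n = \<lparr>verts = {..<n}, edges = {e. e \<subseteq> {..<n} \<and> card e = 2}\<rparr>"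

definition complete_bipartite_graph :: "nat \<Rightarrow> nat \<Rightarrow> nat ugraph" where
  "complete_bipartite_graph a b =
     \<lparr>verts = {..<a + b}, edges = {{i, j} | i j. i \<in> {..<a} \<and> j \<in> {a..<a + b}}\<rparr>"

text \<open>Degrees are taken in the host graph \<open>F\<close>, not in the subgraph \<open>H\<close>.\<close>

definition singular :: "'a ugraph \<Rightarrow> 'a ugraph \<Rightarrow> bool" where
  "singular F H \<longleftrightarrow>
     (\<forall>u\<in>verts H. \<forall>v\<in>verts H. degree F u = degree F v) \<or> inj_on (degree F) (verts H)"

text \<open>A 2-coloring is a function \<open>c\<close> to \<^typ>\<open>bool\<close>; only its values on the edges of the
  complete graph on \<open>m\<close> vertices matter.\<close>

definition color_graph :: "nat \<Rightarrow> (nat set \<Rightarrow> bool) \<Rightarrow> bool \<Rightarrow> nat ugraph" where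
  "color_graph m c i =
     \<lparr>verts = verts (complete_graph m), edges = {e \<in> edges (complete_graph m). c e = i}\<rparr>"

definition contains_singular_copy :: "'a ugraph \<Rightarrow> 'b ugraph \<Rightarrow> bool" where
  "contains_singular_copy F G \<longleftrightarrow> (\<exists>H. subgraph H F \<and> singular F H \<and> isomorphic H G)"

text \<open>The value is an extended natural number, so that it is \<open>\<infinity>\<close> rather than unspecified
  in case no threshold exists.\<close>

definition Rs :: "'a ugraph \<Rightarrow> enat" where
  "Rs G = Inf {enat N | N. \<forall>m\<ge>N. \<forall>c. \<exists>i. contains_singular_copy (color_graph m c i) G}"

end

theory Submission
  imports Defs
begin

text \<open>
  The degrees of a vertex in the two colors of \<open>K\<^sub>m\<close> add up to \<open>m - 1\<close>, so whether two vertices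
  have equal degrees does not depend on the color, and neither does the partition of the
  vertices into degree classes. A singular copy is a monochromatic copy whose vertices lie all
  in one class or all in different classes.

  A triangle is forced by a claw (\<open>singular_triangle_of_claw\<close>): either two leaves are joined in
  the color of the claw and form a triangle with its center, or the three leaves form a triangle
  in the other color; a part of a singular vertex set is singular. So it suffices to find a
  singular claw for every \<open>m \<ge> 22\<close> and to avoid singular triangles for \<open>m = 21\<close>.

  Suppose that there is no singular claw (\<open>no_singular_claw_bound\<close>). In its own class a vertex has
  at most two neighbors in each color, so a class has at most \<open>1 + 2 + 2 = 5\<close> vertices. Outside
  of its own class, the neighbors of a vertex in one color meet at most two classes, since three
  neighbors from three further classes would be the leaves of a singular claw. Hence every degree
  in either color is at most \<open>2 + 5 + 5 = 12\<close>, and every degree in a fixed color lies between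
  \<open>m - 13\<close> and \<open>12\<close>. For \<open>m \<ge> 22\<close> this leaves at most \<open>26 - m \<le> 4\<close> classes, hence at most \<open>20\<close>
  vertices, which is absurd.

  For \<open>m = 21\<close> the same bounds permit the five degrees \<open>8, \<dots>, 12\<close>, and all of them are needed,
  since four classes have at most \<open>20\<close> vertices. They are realized by a blow-up of the 2-coloring
  of \<open>K\<^sub>5\<close> into two 5-cycles: replace the five vertices by classes of sizes \<open>5, 5, 5, 4, 2\<close> and
  color the inside of each class regularly and without monochromatic triangles
  (\<open>blowup_no_singular_triangle\<close>).
\<close>

section \<open>Singular copies as embeddings\<close>

definition singular_set :: "'a ugraph \<Rightarrow> 'a set \<Rightarrow> bool" where
  "singular_set F S \<longleftrightarrow> (\<forall>u\<in>S. \<forall>v\<in>S. degree F u = degree F v) \<or> inj_on (degree F) S"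

lemma singular_set_subset:
  assumes "singular_set F S" "T \<subseteq> S"
  shows "singular_set F T"
  using assms unfolding singular_set_def by (meson inj_on_subset subsetD)

lemma singular_iff_singular_set: "singular F H \<longleftrightarrow> singular_set F (verts H)"
  by (simp add: singular_def singular_set_def)

text \<open>Singularity depends on the vertex set of the copy only, so the copy can be taken to be the
  image of \<open>G\<close>, without further edges of \<open>F\<close>.\<close>

lemma contains_singular_copy_iff_embedding:
  assumes F: "simple_graph F" and G: "simple_graph G"
  shows "contains_singular_copy F G \<longleftrightarrow>
    (\<exists>f. inj_on f (verts G) \<and> f ` verts G \<subseteq> verts F \<and> singular_set F (f ` verts G) \<and>
         (\<forall>u\<in>verts G. \<forall>v\<in>verts G. {u, v} \<in> edges G \<longrightarrow> {f u, f v} \<in> edges F))"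
    (is "?L \<longleftrightarrow> (\<exists>f. ?emb f)")
proof
  assume ?L
  then obtain H g where sub: "subgraph H F" and sing: "singular_set F (verts H)"
    and g: "bij_betw g (verts H) (verts G)"
    and ge: "\<And>u v. u \<in> verts H \<Longrightarrow> v \<in> verts H \<Longrightarrow> {u, v} \<in> edges H \<longleftrightarrow> {g u, g v} \<in> edges G"
    unfolding contains_singular_copy_def isomorphic_def singular_iff_singular_set by blast
  define f where "f = inv_into (verts H) g"
  have f: "bij_betw f (verts G) (verts H)"
    unfolding f_def by (rule bij_betw_inv_into[OF g])
  have gf: "g (f u) = u" if "u \<in> verts G" for u
    using bij_betw_inv_into_right[OF g that] by (simp add: f_def)
  have im: "f ` verts G = verts H"
    using f by (simp add: bij_betw_def)
  have "{f u, f v} \<in> edges F" if "u \<in> verts G" "v \<in> verts G" "{u, v} \<in> edges G" for u v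
    using that ge[of "f u" "f v"] gf im sub unfolding subgraph_def by auto
  then have "?emb f"
    using f im sing sub unfolding bij_betw_def subgraph_def by auto
  then show "\<exists>f. ?emb f" by blast
next
  assume "\<exists>f. ?emb f"
  then obtain f where inj: "inj_on f (verts G)" and im: "f ` verts G \<subseteq> verts F"
    and sing: "singular_set F (f ` verts G)"
    and fe: "\<And>u v. u \<in> verts G \<Longrightarrow> v \<in> verts G \<Longrightarrow> {u, v} \<in> edges G \<Longrightarrow> {f u, f v} \<in> edges F"
    by blast
  define H where "H = \<lparr>verts = f ` verts G, edges = (`) f ` edges G\<rparr>"
  have sub_e: "e \<subseteq> verts G" if "e \<in> edges G" for e
    using G that by (simp add: simple_graph_def)
  have card_e: "card e = 2" if "e \<in> edges G" for e
    using G that by (simp add: simple_graph_def)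
  have "f ` e \<in> edges F" if e: "e \<in> edges G" for e
  proof -
    obtain u v where uv: "e = {u, v}"
      using card_e[OF e] by (auto simp: card_2_iff)
    with sub_e[OF e] fe[of u v] e show ?thesis by simp
  qed
  moreover have "simple_graph H"
    using G sub_e card_e card_image[OF inj_on_subset[OF inj]]
    unfolding simple_graph_def H_def by (simp add: image_mono)
  ultimately have "subgraph H F"
    using F im by (auto simp: subgraph_def H_def)
  moreover have "singular F H"
    using sing by (simp add: singular_iff_singular_set H_def)
  moreover have "isomorphic H G"
  proof -
    let ?g = "inv_into (verts G) f"
    have "bij_betw ?g (verts H) (verts G)"
      using bij_betw_inv_into[OF inj_on_imp_bij_betw[OF inj]] by (simp add: H_def)
    moreover have "{x, y} \<in> edges H \<longleftrightarrow> {?g x, ?g y} \<in> edges G"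
      if "x \<in> verts H" "y \<in> verts H" for x y
    proof -
      obtain u v where uv: "u \<in> verts G" "v \<in> verts G" "x = f u" "y = f v"
        using \<open>x \<in> verts H\<close> \<open>y \<in> verts H\<close> by (auto simp: H_def)
      have "{x, y} = f ` {u, v}" using uv by simp
      then have "{x, y} \<in> edges H \<longleftrightarrow> (\<exists>e\<in>edges G. f ` {u, v} = f ` e)"
        by (auto simp: H_def)
      also have "\<dots> \<longleftrightarrow> {u, v} \<in> edges G"
        using inj_on_image_eq_iff[OF inj, of "{u, v}"] sub_e uv
        by (metis empty_subsetI insert_subset)
      finally show ?thesis using uv inj by simp
    qed
    ultimately show ?thesis unfolding isomorphic_def by blast
  qed
  ultimately show ?L unfolding contains_singular_copy_def by blast
qed

section \<open>Degrees in the two colors\<close>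

definition nbrs :: "nat \<Rightarrow> (nat set \<Rightarrow> bool) \<Rightarrow> bool \<Rightarrow> nat \<Rightarrow> nat set" where
  "nbrs m c i v = {u. u < m \<and> u \<noteq> v \<and> c {u, v} = i}"

lemma finite_nbrs [simp]: "finite (nbrs m c i v)"
  by (simp add: nbrs_def)

lemma verts_color_graph [simp]: "verts (color_graph m c i) = {..<m}"
  by (simp add: color_graph_def complete_graph_def)

lemma edge_color_graph [simp]:
  "{u, v} \<in> edges (color_graph m c i) \<longleftrightarrow> u < m \<and> v < m \<and> u \<noteq> v \<and> c {u, v} = i"
  by (auto simp: color_graph_def complete_graph_def card_2_iff doubleton_eq_iff)

lemma simple_color_graph: "simple_graph (color_graph m c i)"
  by (auto simp: simple_graph_def color_graph_def complete_graph_def)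

lemma degree_color_graph:
  assumes "v < m"
  shows "degree (color_graph m c i) v = card (nbrs m c i v)"
proof -
  have "{e \<in> edges (color_graph m c i). v \<in> e} = (\<lambda>u. {u, v}) ` nbrs m c i v"
    using assms
    by (auto simp: color_graph_def complete_graph_def card_2_iff nbrs_def image_iff insert_commute)
  moreover have "inj_on (\<lambda>u. {u, v}) (nbrs m c i v)"
    by (auto simp: inj_on_def nbrs_def doubleton_eq_iff)
  ultimately show ?thesis by (simp add: degree_def card_image)
qed

lemma degrees_of_two_colors:
  assumes "v < m"
  shows "degree (color_graph m c i) v + degree (color_graph m c (\<not> i)) v = m - 1"
proof -
  have "card (nbrs m c i v) + card (nbrs m c (\<not> i) v) = card (nbrs m c i v \<union> nbrs m c (\<not> i) v)"
    by (rule card_Un_disjoint[symmetric]) (auto simp: nbrs_def)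
  also have "nbrs m c i v \<union> nbrs m c (\<not> i) v = {..<m} - {v}"
    by (auto simp: nbrs_def)
  finally show ?thesis using assms by (simp add: degree_color_graph)
qed

lemma singular_set_color_indep:
  assumes "S \<subseteq> {..<m}"
  shows "singular_set (color_graph m c i) S \<longleftrightarrow> singular_set (color_graph m c j) S"
proof (cases "i = j")
  case False
  then have j: "j = (\<not> i)" by blast
  have "degree (color_graph m c i) u = degree (color_graph m c i) v
      \<longleftrightarrow> degree (color_graph m c j) u = degree (color_graph m c j) v"
    if "u \<in> S" "v \<in> S" for u v
  proof -
    have "u < m" "v < m" using that assms by auto
    from this[THEN degrees_of_two_colors, of c i] show ?thesis
      unfolding j by linarith
  qed
  then show ?thesis unfolding singular_set_def inj_on_def by blast
qed simp

section \<open>Singular triangles and claws\<close>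

lemma singular_triangle_iff:
  "contains_singular_copy (color_graph m c i) (complete_graph 3) \<longleftrightarrow>
   (\<exists>x y z. x < m \<and> y < m \<and> z < m \<and> x \<noteq> y \<and> y \<noteq> z \<and> x \<noteq> z \<and>
      c {x, y} = i \<and> c {y, z} = i \<and> c {x, z} = i \<and>
      singular_set (color_graph m c i) {x, y, z})" (is "?L \<longleftrightarrow> ?R")
proof -
  have V: "{..<3::nat} = {0, 1, 2}" by auto
  have simple: "simple_graph (complete_graph 3)"
    by (auto simp: simple_graph_def complete_graph_def)
  have E: "{u, v} \<in> edges (complete_graph 3) \<longleftrightarrow> u < 3 \<and> v < 3 \<and> u \<noteq> v" for u v
    by (auto simp: complete_graph_def card_2_iff doubleton_eq_iff)
  note iff = contains_singular_copy_iff_embedding[OF simple_color_graph simple, of m c i]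
  have vs: "verts (complete_graph 3) = {0, 1, 2}" by (simp add: complete_graph_def V)
  show ?thesis
  proof
    assume ?L
    then obtain f where "inj_on f {0, 1, 2}" "f ` {0, 1, 2} \<subseteq> {..<m}"
      "singular_set (color_graph m c i) (f ` {0, 1, 2})"
      "\<forall>u\<in>{0, 1, 2}. \<forall>v\<in>{0, 1, 2}. {u, v} \<in> edges (complete_graph 3) \<longrightarrow>
         {f u, f v} \<in> edges (color_graph m c i)"
      unfolding iff vs verts_color_graph by blast
    then show ?R
      by (intro exI[of _ "f 0"] exI[of _ "f 1"] exI[of _ "f 2"]) (auto simp: E)
  next
    assume ?R
    then obtain x y z where *: "x < m" "y < m" "z < m" "x \<noteq> y" "y \<noteq> z" "x \<noteq> z"
      "c {x, y} = i" "c {y, z} = i" "c {x, z} = i"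
      "singular_set (color_graph m c i) {x, y, z}" by blast
    define f where "f = (\<lambda>n::nat. if n = 0 then x else if n = 1 then y else z)"
    have "f ` {0, 1, 2} = {x, y, z}" "inj_on f {0, 1, 2}"
      using * by (auto simp: f_def)
    then show ?L
      unfolding iff vs using *
      by (intro exI[of _ f]) (auto simp: E f_def insert_commute)
  qed
qed

lemma singular_claw_iff:
  "contains_singular_copy (color_graph m c i) (complete_bipartite_graph 1 3) \<longleftrightarrow>
   (\<exists>v A. v < m \<and> A \<subseteq> nbrs m c i v \<and> card A = 3 \<and>
      singular_set (color_graph m c i) (insert v A))" (is "?L \<longleftrightarrow> ?R")
proof -
  let ?G = "complete_bipartite_graph 1 3"
  have V: "{..<4::nat} = {0, 1, 2, 3}" by auto
  have simple: "simple_graph ?G"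
    by (auto simp: simple_graph_def complete_bipartite_graph_def card_2_iff)
  have E: "{u, v} \<in> edges ?G \<longleftrightarrow> (u = 0 \<and> v \<in> {1, 2, 3}) \<or> (v = 0 \<and> u \<in> {1, 2, 3})" for u v
    by (auto simp: complete_bipartite_graph_def doubleton_eq_iff)
  note iff = contains_singular_copy_iff_embedding[OF simple_color_graph simple, of m c i]
  have vs: "verts ?G = {0, 1, 2, 3}" by (simp add: complete_bipartite_graph_def V)
  show ?thesis
  proof
    assume ?L
    then obtain f where f: "inj_on f {0, 1, 2, 3}" "f ` {0, 1, 2, 3} \<subseteq> {..<m}"
      "singular_set (color_graph m c i) (f ` {0, 1, 2, 3})"
      "\<forall>u\<in>{0, 1, 2, 3}. \<forall>v\<in>{0, 1, 2, 3}. {u, v} \<in> edges ?G \<longrightarrow>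
         {f u, f v} \<in> edges (color_graph m c i)"
      unfolding iff vs verts_color_graph by blast
    have leaf: "f j \<in> nbrs m c i (f 0)" if "j \<in> {1, 2, 3}" for j
    proof -
      have "{j, 0} \<in> edges ?G" unfolding E using that by blast
      then have "{f j, f 0} \<in> edges (color_graph m c i)" using f(4) that by blast
      then show ?thesis by (simp add: nbrs_def)
    qed
    have "f 0 < m" using f(2) by simp
    moreover have "f ` {1, 2, 3} \<subseteq> nbrs m c i (f 0)" using leaf by blast
    moreover have "card (f ` {1, 2, 3}) = 3"
      using card_image[OF inj_on_subset[OF f(1)], of "{1, 2, 3}"] by simp
    moreover have "insert (f 0) (f ` {1, 2, 3}) = f ` {0, 1, 2, 3}" by simp
    ultimately show ?R using f(3) by metis
  next
    assume ?R
    then obtain v A where v: "v < m" and A: "A \<subseteq> nbrs m c i v" "card A = 3"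
      and sing: "singular_set (color_graph m c i) (insert v A)" by blast
    from A(2) obtain x y z where xyz: "A = {x, y, z}" "x \<noteq> y" "y \<noteq> z" "x \<noteq> z"
      by (auto simp: card_3_iff)
    define f where "f = (\<lambda>n::nat. if n = 0 then v else if n = 1 then x else if n = 2 then y else z)"
    have mem: "x \<in> nbrs m c i v" "y \<in> nbrs m c i v" "z \<in> nbrs m c i v"
      using A(1) xyz(1) by simp_all
    have "f ` {0, 1, 2, 3} = insert v A" by (auto simp: f_def xyz(1))
    moreover have "inj_on f {0, 1, 2, 3}"
      using mem xyz(2-4) by (auto simp: f_def nbrs_def)
    moreover have "insert v A \<subseteq> {..<m}"
      using v A(1) by (auto simp: nbrs_def)
    moreover have "{f a, f b} \<in> edges (color_graph m c i)" if "{a, b} \<in> edges ?G" for a b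
    proof -
      have leaf: "{v, f j} \<in> edges (color_graph m c i)" if "j \<in> {1, 2, 3}" for j
        using mem v that by (auto simp: f_def nbrs_def insert_commute)
      have "f 0 = v" by (simp add: f_def)
      with leaf that show ?thesis unfolding E by (metis insert_commute)
    qed
    ultimately show ?L
      unfolding iff vs verts_color_graph using sing by (intro exI[of _ f]) simp
  qed
qed

text \<open>This is the step in the proof of \<open>R(3,3) = 6\<close>: the edges among the three leaves either
  avoid the color of the claw or close a triangle with its center.\<close>

lemma singular_triangle_of_claw:
  assumes "contains_singular_copy (color_graph m c i) (complete_bipartite_graph 1 3)"
  shows "\<exists>j. contains_singular_copy (color_graph m c j) (complete_graph 3)"
proof -
  from assms obtain v A where v: "v < m" and A: "A \<subseteq> nbrs m c i v" "card A = 3"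
    and sing: "singular_set (color_graph m c i) (insert v A)"
    unfolding singular_claw_iff by blast
  have lt: "insert v A \<subseteq> {..<m}"
    using v A(1) by (auto simp: nbrs_def)
  have sing': "singular_set (color_graph m c j) T" if "T \<subseteq> insert v A" for T j
    using singular_set_color_indep[OF lt] sing singular_set_subset that by metis
  show ?thesis
  proof (cases "\<exists>x\<in>A. \<exists>y\<in>A. x \<noteq> y \<and> c {x, y} = i")
    case True
    then obtain x y where xy: "x \<in> A" "y \<in> A" "x \<noteq> y" "c {x, y} = i" by blast
    then have "x < m" "y < m" "x \<noteq> v" "y \<noteq> v" "c {x, v} = i" "c {y, v} = i"
      using A(1) by (auto simp: nbrs_def)
    moreover have "singular_set (color_graph m c i) {x, y, v}"
      by (rule sing') (use xy in auto)
    ultimately have "contains_singular_copy (color_graph m c i) (complete_graph 3)"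
      unfolding singular_triangle_iff using xy v by blast
    then show ?thesis ..
  next
    case False
    from A(2) obtain x y z where xyz: "A = {x, y, z}" "x \<noteq> y" "y \<noteq> z" "x \<noteq> z"
      by (auto simp: card_3_iff)
    then have "x < m" "y < m" "z < m"
      using A(1) by (auto simp: nbrs_def)
    moreover have "c {x, y} = (\<not> i)" "c {y, z} = (\<not> i)" "c {x, z} = (\<not> i)"
      using False xyz by blast+
    moreover have "singular_set (color_graph m c (\<not> i)) {x, y, z}"
      by (rule sing') (use xyz in auto)
    ultimately have "contains_singular_copy (color_graph m c (\<not> i)) (complete_graph 3)"
      unfolding singular_triangle_iff using xyz by blast
    then show ?thesis ..
  qed
qed

section \<open>Colorings without singular claws\<close>

lemma no_singular_claw_nbrs_le:
  assumes no: "\<not> contains_singular_copy (color_graph m c i) (complete_bipartite_graph 1 3)"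
    and S: "S \<subseteq> {..<m}" "singular_set (color_graph m c i) S" and v: "v \<in> S"
  shows "card (nbrs m c i v \<inter> S) \<le> 2"
proof (rule ccontr)
  assume "\<not> ?thesis"
  then have "3 \<le> card (nbrs m c i v \<inter> S)" by simp
  then obtain A where A: "A \<subseteq> nbrs m c i v \<inter> S" "card A = 3"
    by (rule obtain_subset_with_card_n)
  have "singular_set (color_graph m c i) (insert v A)"
    using S(2) by (rule singular_set_subset) (use A v in auto)
  moreover have "A \<subseteq> nbrs m c i v" "v < m" using A S(1) v by auto
  ultimately show False
    using no A(2) unfolding singular_claw_iff by blast
qed

lemma no_singular_claw_bound:
  assumes no: "\<And>i. \<not> contains_singular_copy (color_graph m c i) (complete_bipartite_graph 1 3)"
  shows "m \<le> 21"
proof -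
  define d where "d = degree (color_graph m c True)"
  define cls where "cls k = {u. u < m \<and> d u = k}" for k
  have fin: "finite (cls k)" for k by (simp add: cls_def)
  have small: "card (nbrs m c i v \<inter> S) \<le> 2"
    if "S \<subseteq> {..<m}" "v \<in> S" "(\<forall>u\<in>S. \<forall>w\<in>S. d u = d w) \<or> inj_on d S" for S v i
  proof -
    have "singular_set (color_graph m c True) S"
      using that(3) by (simp add: singular_set_def d_def)
    then have "singular_set (color_graph m c i) S"
      using singular_set_color_indep[OF that(1)] by blast
    then show ?thesis using no_singular_claw_nbrs_le[OF no that(1)] that(2) by blast
  qed
  have inside: "card (nbrs m c i v \<inter> cls (d v)) \<le> 2" if "v < m" for v i
    using that by (intro small) (auto simp: cls_def)
  have cls_le: "card (cls k) \<le> 5" for k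
  proof (cases "cls k = {}")
    case False
    then obtain v where v: "v < m" "k = d v" by (auto simp: cls_def)
    have "cls k \<subseteq> {v} \<union> (nbrs m c True v \<inter> cls k \<union> nbrs m c False v \<inter> cls k)"
      by (auto simp: cls_def nbrs_def)
    then have "card (cls k) \<le> card ({v} \<union> (nbrs m c True v \<inter> cls k \<union> nbrs m c False v \<inter> cls k))"
      by (rule card_mono[rotated]) simp
    also have "\<dots> \<le> card {v} + (card (nbrs m c True v \<inter> cls k) + card (nbrs m c False v \<inter> cls k))"
      by (meson card_Un_le le_trans add_left_mono)
    finally show ?thesis using inside[OF v(1), of True] inside[OF v(1), of False] v(2) by simp
  qed simp
  have deg_le: "card (nbrs m c i v) \<le> 12" if v: "v < m" for v i
  proof -
    let ?N = "nbrs m c i v - cls (d v)"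
    \<comment> \<open>One neighbor from each further class; together with \<open>v\<close> they have distinct degrees.\<close>
    obtain B where B: "B \<subseteq> ?N" "inj_on d B" "d ` B = d ` ?N"
      by (metis subset_image_inj order_refl)
    have ne: "d u \<noteq> d v" if "u \<in> B" for u
      using that B(1) by (auto simp: cls_def nbrs_def)
    have "inj_on d (insert v B)"
      using B(2) ne by (fastforce simp: inj_on_insert)
    then have "card (nbrs m c i v \<inter> insert v B) \<le> 2"
      using B(1) v by (intro small) (auto simp: nbrs_def)
    moreover have "nbrs m c i v \<inter> insert v B = B"
      using B(1) by (auto simp: nbrs_def)
    ultimately have two: "card (d ` ?N) \<le> 2"
      using card_image[OF B(2)] B(3) by simp
    have "nbrs m c i v \<subseteq> nbrs m c i v \<inter> cls (d v) \<union> (\<Union>k\<in>d ` ?N. cls k)"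
      by (auto simp: cls_def nbrs_def)
    then have "card (nbrs m c i v) \<le> card (nbrs m c i v \<inter> cls (d v) \<union> (\<Union>k\<in>d ` ?N. cls k))"
      by (rule card_mono[rotated]) (simp add: fin)
    also have "\<dots> \<le> card (nbrs m c i v \<inter> cls (d v)) + card (\<Union>k\<in>d ` ?N. cls k)"
      by (rule card_Un_le)
    also have "card (\<Union>k\<in>d ` ?N. cls k) \<le> (\<Sum>k\<in>d ` ?N. card (cls k))"
      by (rule card_UN_le) simp
    also have "\<dots> \<le> card (d ` ?N) * 5"
      using sum_bounded_above[of "d ` ?N" "\<lambda>k. card (cls k)" 5] cls_le by simp
    finally show ?thesis using inside[OF v, of i] two by linarith
  qed
  have "d ` {..<m} \<subseteq> {m - 13..12}"
  proof
    fix k assume "k \<in> d ` {..<m}"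
    then obtain v where v: "v < m" "k = d v" by blast
    then show "k \<in> {m - 13..12}"
      using deg_le[of v True] deg_le[of v False] degrees_of_two_colors[of v m c True]
      by (simp add: d_def degree_color_graph)
  qed
  then have "card (d ` {..<m}) \<le> card {m - 13..12}"
    by (rule card_mono[rotated]) simp
  then have few: "card (d ` {..<m}) \<le> 13 - (m - 13)" by simp
  have "{..<m} = (\<Union>k\<in>d ` {..<m}. cls k)" by (auto simp: cls_def)
  then have "m = card (\<Union>k\<in>d ` {..<m}. cls k)" by (metis card_lessThan)
  also have "\<dots> \<le> (\<Sum>k\<in>d ` {..<m}. card (cls k))"
    by (rule card_UN_le) simp
  also have "\<dots> \<le> card (d ` {..<m}) * 5"
    using sum_bounded_above[of "d ` {..<m}" "\<lambda>k. card (cls k)" 5] cls_le by simp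
  finally show ?thesis using few by linarith
qed

section \<open>A coloring on 21 vertices\<close>

text \<open>The classes are \<open>{0..4}\<close>, \<open>{5..9}\<close>, \<open>{10..14}\<close>, \<open>{15..18}\<close> and \<open>{19, 20}\<close>.\<close>

definition part :: "nat \<Rightarrow> nat" where
  "part x = (if x < 19 then x div 5 else 4)"

definition pentagon :: "nat \<Rightarrow> nat \<Rightarrow> bool" where
  "pentagon a b \<longleftrightarrow> (a + 1) mod 5 = b mod 5 \<or> (b + 1) mod 5 = a mod 5"

text \<open>Each class is regular inside: the classes of size 5 are 5-cycles in both colors; in the
  class of size 4 the color \<open>True\<close> is the perfect matching \<open>15-16, 17-18\<close> and \<open>False\<close>
  a 4-cycle; the edge \<open>19-20\<close> has color \<open>True\<close>.\<close>

definition blowup_adj :: "nat \<Rightarrow> nat \<Rightarrow> bool" where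
  "blowup_adj x y \<longleftrightarrow>
     (if part x \<noteq> part y then pentagon (part x) (part y)
      else if x < 15 then pentagon x y
      else (x + 1) div 2 = (y + 1) div 2)"

definition blowup_coloring :: "nat set \<Rightarrow> bool" where
  "blowup_coloring e \<longleftrightarrow> (\<exists>x y. e = {x, y} \<and> blowup_adj x y)"

lemma part_less: "x < 21 \<Longrightarrow> part x < 5"
  by (auto simp: part_def)

lemma part_eq_less_15: "part x = part y \<Longrightarrow> x < 15 \<longleftrightarrow> y < 15"
proof -
  have "part x < 3 \<longleftrightarrow> x < 15" for x
    by (auto simp: part_def div_less_iff_less_mult)
  then show "part x = part y \<Longrightarrow> x < 15 \<longleftrightarrow> y < 15" by metis
qed

lemma pentagon_sym: "pentagon a b \<longleftrightarrow> pentagon b a"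
  by (auto simp: pentagon_def)

lemma blowup_adj_sym: "blowup_adj x y \<longleftrightarrow> blowup_adj y x"
  using part_eq_less_15[of x y] pentagon_sym by (auto simp: blowup_adj_def)

lemma blowup_coloring_pair: "blowup_coloring {x, y} \<longleftrightarrow> blowup_adj x y"
  using blowup_adj_sym by (auto simp: blowup_coloring_def doubleton_eq_iff)

lemma pentagon_no_mono_triangle:
  assumes "a mod 5 \<noteq> b mod 5" "b mod 5 \<noteq> c mod 5" "a mod 5 \<noteq> c mod 5"
  shows "\<not> (pentagon a b = i \<and> pentagon b c = i \<and> pentagon a c = i)"
proof -
  have *: "\<not> (pentagon a b = i \<and> pentagon b c = i \<and> pentagon a c = i)"
    if "a \<in> {0, 1, 2, 3, 4}" "b \<in> {0, 1, 2, 3, 4}" "c \<in> {0, 1, 2, 3, 4}"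
       "a \<noteq> b" "b \<noteq> c" "a \<noteq> c" for a b c
    using that by (cases i) (auto simp: pentagon_def)
  have mod5: "x mod 5 \<in> {0, 1, 2, 3, 4}" for x :: nat by auto
  have "pentagon x y \<longleftrightarrow> pentagon (x mod 5) (y mod 5)" for x y
    by (simp add: pentagon_def mod_simps)
  then show ?thesis using *[OF mod5 mod5 mod5 assms] by simp
qed

text \<open>The five degrees are distinct, so the degree classes are exactly the blown-up vertices
  of the pentagon.\<close>

lemma blowup_degree:
  assumes "x < 21"
  shows "degree (color_graph 21 blowup_coloring True) x = [9, 12, 11, 8, 10] ! part x"
proof -
  have "{u. u < 21 \<and> u \<noteq> x \<and> blowup_adj u x} = set (filter (\<lambda>u. u \<noteq> x \<and> blowup_adj u x) [0..<21])"
    by auto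
  then have *: "degree (color_graph 21 blowup_coloring True) x
      = length (filter (\<lambda>u. u \<noteq> x \<and> blowup_adj u x) [0..<21])"
    using assms by (simp add: degree_color_graph nbrs_def blowup_coloring_pair
      flip: distinct_card)
  have "\<forall>x\<in>set [0..<21]. length (filter (\<lambda>u. u \<noteq> x \<and> blowup_adj u x) [0..<21])
      = [9, 12, 11, 8, 10] ! part x"
    by code_simp
  then show ?thesis using assms * by simp
qed

lemma blowup_same_degree_iff:
  assumes "x < 21" "y < 21"
  shows "degree (color_graph 21 blowup_coloring True) x = degree (color_graph 21 blowup_coloring True) y
    \<longleftrightarrow> part x = part y"
proof -
  have "distinct [9, 12, 11, 8, 10 :: nat]" by simp
  moreover have "part x < length [9, 12, 11, 8, 10 :: nat]" "part y < length [9, 12, 11, 8, 10 :: nat]"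
    using part_less[OF assms(1)] part_less[OF assms(2)] by simp_all
  ultimately show ?thesis
    unfolding blowup_degree[OF assms(1)] blowup_degree[OF assms(2)] by (rule nth_eq_iff_index_eq)
qed

lemma blowup_no_singular_triangle:
  "\<not> contains_singular_copy (color_graph 21 blowup_coloring i) (complete_graph 3)"
proof
  assume "contains_singular_copy (color_graph 21 blowup_coloring i) (complete_graph 3)"
  then obtain x y z where lt: "x < 21" "y < 21" "z < 21" and ne: "x \<noteq> y" "y \<noteq> z" "x \<noteq> z"
    and mono: "blowup_adj x y = i" "blowup_adj y z = i" "blowup_adj x z = i"
    and sing: "singular_set (color_graph 21 blowup_coloring i) {x, y, z}"
    unfolding singular_triangle_iff blowup_coloring_pair by blast
  have "singular_set (color_graph 21 blowup_coloring True) {x, y, z}"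
    using sing singular_set_color_indep[of "{x, y, z}" 21] lt by blast
  then consider (rainbow) "part x \<noteq> part y" "part y \<noteq> part z" "part x \<noteq> part z"
    | (same) "part x = part y" "part y = part z"
    using ne lt by (auto simp: singular_set_def inj_on_def blowup_same_degree_iff)
  then show False
  proof cases
    case rainbow
    then show False
      using mono pentagon_no_mono_triangle[of "part x" "part y" "part z" i] part_less lt
      by (simp add: blowup_adj_def)
  next
    case same
    show False
    proof (cases "x < 15")
      case True
      then have lt15: "x < 15" "y < 15" "z < 15" using same part_eq_less_15 by blast+
      then have "x div 5 = y div 5" "y div 5 = z div 5"
        using same by (simp_all add: part_def)
      then have "x mod 5 \<noteq> y mod 5" "y mod 5 \<noteq> z mod 5" "x mod 5 \<noteq> z mod 5"
        using ne by (metis div_mult_mod_eq)+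
      then show False
        using mono pentagon_no_mono_triangle[of x y z i] same lt15 by (simp add: blowup_adj_def)
    next
      case False
      then have ge15: "\<not> x < 15" "\<not> y < 15" "\<not> z < 15" using same part_eq_less_15 by blast+
      then have mono': "((x + 1) div 2 = (y + 1) div 2) = i"
        "((y + 1) div 2 = (z + 1) div 2) = i" "((x + 1) div 2 = (z + 1) div 2) = i"
        using mono same by (simp_all add: blowup_adj_def)
      \<comment> \<open>Only two numbers have the same value of \<open>(u + 1) div 2\<close>, and this function takes at most
        two values on each of the two small classes; neither is possible for three vertices.\<close>
      show False
      proof (cases i)
        case True
        have "u \<in> {2 * ((u + 1) div 2) - 1, 2 * ((u + 1) div 2)}" for u :: nat by auto
        with True mono' ne show False by (metis insertE singletonD)
      next
        case False
        have "(u + 1) div 2 \<in> {8, 9} \<and> part u = 3 \<or> (u + 1) div 2 = 10 \<and> part u = 4"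
          if "u < 21" "\<not> u < 15" for u
        proof -
          have "u \<in> {15, 16, 17, 18, 19, 20}" using that by auto
          then show ?thesis by (auto simp: part_def)
        qed
        from this[OF lt(1) ge15(1)] this[OF lt(2) ge15(2)] this[OF lt(3) ge15(3)]
        show False using False mono' same by auto
      qed
    qed
  qed
qed

section \<open>The singular Ramsey numbers\<close>

lemma Rs_eqI:
  assumes upper: "\<And>m c. n < m \<Longrightarrow> \<exists>i. contains_singular_copy (color_graph m c i) G"
    and lower: "\<And>i. \<not> contains_singular_copy (color_graph n c i) G"
  shows "Rs G = enat (Suc n)"
  unfolding Rs_def
proof (rule antisym)
  show "Inf {enat N |N. \<forall>m\<ge>N. \<forall>c. \<exists>i. contains_singular_copy (color_graph m c i) G}
      \<le> enat (Suc n)"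
    using upper by (intro Inf_lower) auto
  show "enat (Suc n)
      \<le> Inf {enat N |N. \<forall>m\<ge>N. \<forall>c. \<exists>i. contains_singular_copy (color_graph m c i) G}"
  proof (rule Inf_greatest)
    fix k assume "k \<in> {enat N |N. \<forall>m\<ge>N. \<forall>c. \<exists>i. contains_singular_copy (color_graph m c i) G}"
    then obtain N where N: "k = enat N"
      "\<forall>m\<ge>N. \<forall>c. \<exists>i. contains_singular_copy (color_graph m c i) G" by blast
    with lower have "\<not> N \<le> n" by blast
    then show "enat (Suc n) \<le> k" by (simp add: N(1) not_le Suc_le_eq)
  qed
qed

theorem theorem27:
  "Rs (complete_graph 3) = 22 \<and> Rs (complete_bipartite_graph 1 3) = 22"
proof
  have claw: "\<exists>i. contains_singular_copy (color_graph m c i) (complete_bipartite_graph 1 3)"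
    if "21 < m" for m c
    using no_singular_claw_bound[of m c] that by force
  have "Rs (complete_graph 3) = enat (Suc 21)"
    using claw singular_triangle_of_claw blowup_no_singular_triangle by (intro Rs_eqI) blast+
  then show "Rs (complete_graph 3) = 22" by (simp add: numeral_eq_enat)
  have "Rs (complete_bipartite_graph 1 3) = enat (Suc 21)"
    using claw singular_triangle_of_claw blowup_no_singular_triangle by (intro Rs_eqI) blast+
  then show "Rs (complete_bipartite_graph 1 3) = 22" by (simp add: numeral_eq_enat)
qed

end
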